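(* Let $n\ge 2$ be an integer and let $D$ be the set of positive divisors of $n$. Let $G=\langle a\rangle$ be a cyclic group of order $n$ and let $S=\{a^{i} : i\in B(1,n)\}$, where $B(1,n)=\{t\in\mathbb{N} : 1\le t\le n,\ \gcd(t,n)=1\}$. Let $X=\{d\in D : p^{2}\mid d \text{ for some prime } p\}$, and let $d_1,\ldots,d_t$ be the distinct elements of $D\setminus (X\cup\{1\})$. For a square-free divisor $d\in D$ with exactly $k$ prime factors put $F(d)=(-1)^{k}\,\phi(n)/\phi(d)$. Then the spectrum of the Cayley graph $X_S(G)$ is $$\mathrm{spec}(X_S(G))=\Big[\phi(n)^{1},\ 0^{\sum_{x\in X}\phi(x)},\ F(d_1)^{\phi(d_1)},\ldots,F(d_t)^{\phi(d_t)}\Big].$$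
   Context: $\phi$ denotes Euler's totient function. For a finite group $G$ and a subset $S\subseteq G$ closed under inverses and not containing the identity, the Cayley graph $X_S(G)$ is the simple undirected graph with vertex set $G$ in which $g_1$ and $g_2$ are adjacent iff $g_1g_2^{-1}\in S$. The spectrum of a graph is the multiset of eigenvalues of its $0/1$ adjacency matrix. The notation $[\lambda_1^{n_1},\ldots,\lambda_r^{n_r}]$ denotes the multiset in which each listed $\lambda_j$ contributes $n_j$ copies. The listed values need not be pairwise distinct (contributions of equal values add up), and an entry with exponent $0$ contributes nothing (so the entry $0$ is absent when $X=\emptyset$). *)

theory Defs
  imports
    "HOL-Algebra.Generated_Groups"
    "HOL-Number_Theory.Totient"
    "HOL-Computational_Algebra.Squarefree"
    "Jordan_Normal_Form.Char_Poly"
    "Graph_Theory.Pair_Digraph"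
begin

section \<open>Cayley graphs\<close>

text \<open>
  Simple undirected graphs are the \<^locale>\<open>pair_graph\<close>s of \<^verbatim>\<open>Graph_Theory\<close>:
  an edge is a symmetric pair of arcs.
\<close>

definition cayley_graph :: "('a, 'b) monoid_scheme \<Rightarrow> 'a set \<Rightarrow> 'a pair_pre_digraph" where
  "cayley_graph G S =
     \<lparr> pverts = carrier G,
       parcs = {(g, h). g \<in> carrier G \<and> h \<in> carrier G \<and> g \<otimes>\<^bsub>G\<^esub> inv\<^bsub>G\<^esub> h \<in> S} \<rparr>"

lemma (in group) pair_graph_cayley_graph:
  assumes "finite (carrier G)"
    and inv_closed: "\<And>s. s \<in> S \<Longrightarrow> inv s \<in> S" and "\<one> \<notin> S"
  shows "pair_graph (cayley_graph G S)"
proof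
  show "finite (parcs (cayley_graph G S))"
    by (rule finite_subset[of _ "carrier G \<times> carrier G"])
      (use assms(1) in \<open>auto simp: cayley_graph_def\<close>)
  have "h \<otimes> inv g \<in> S" if "g \<in> carrier G" "h \<in> carrier G" "g \<otimes> inv h \<in> S" for g h
    using inv_closed[OF that(3)] that by (simp add: inv_mult_group)
  thus "symmetric (with_proj (cayley_graph G S))"
    by (auto simp: symmetric_def cayley_graph_def intro!: symI)
qed (use assms in \<open>auto simp: cayley_graph_def\<close>)


section \<open>Spectrum of a graph\<close>

definition adj_mat :: "'a pair_pre_digraph \<Rightarrow> 'a list \<Rightarrow> complex mat" where
  "adj_mat \<Gamma> vs =
     mat (length vs) (length vs) (\<lambda>(i, j). if (vs ! i, vs ! j) \<in> parcs \<Gamma> then 1 else 0)"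

text \<open>
  Eigenvalues are counted with algebraic multiplicity, over \<open>\<complex>\<close>, so that none can be missed.
  The choice of the enumeration of the vertices is immaterial, see \<open>graph_spectrum_eq\<close> below.
\<close>

definition graph_spectrum :: "'a pair_pre_digraph \<Rightarrow> complex multiset" where
  "graph_spectrum \<Gamma> =
     proots (char_poly (adj_mat \<Gamma> (SOME vs. distinct vs \<and> set vs = pverts \<Gamma>)))"

lemma similar_adj_mat:
  assumes vs: "distinct vs" and ws: "distinct ws" and eq: "set vs = set ws"
  shows "similar_mat (adj_mat \<Gamma> vs) (adj_mat \<Gamma> ws)"
proof -
  define n where "n = length vs"
  have len: "length vs = n" "length ws = n"
    using assms by (auto simp: n_def dest!: distinct_card)
  define \<pi> where "\<pi> i = (THE k. k < n \<and> ws ! k = vs ! i)" for i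
  have \<pi>: "\<pi> i < n" "ws ! \<pi> i = vs ! i" if "i < n" for i
  proof -
    have "\<exists>!k. k < n \<and> ws ! k = vs ! i"
      using that len eq ws by (metis distinct_Ex1 nth_mem)
    from theI'[OF this] show "\<pi> i < n" "ws ! \<pi> i = vs ! i" by (auto simp: \<pi>_def)
  qed
  have iff: "vs ! i = ws ! k \<longleftrightarrow> k = \<pi> i" if "i < n" "k < n" for i k
    using \<pi>[OF that(1)] that len ws by (metis nth_eq_iff_index_eq)
  have ivs: "vs ! i = vs ! j \<longleftrightarrow> i = j" if "i < n" "j < n" for i j
    using that len vs by (simp add: nth_eq_iff_index_eq)
  have iws: "ws ! i = ws ! j \<longleftrightarrow> i = j" if "i < n" "j < n" for i j
    using that len ws by (simp add: nth_eq_iff_index_eq)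
  define P :: "complex mat" where "P = mat n n (\<lambda>(i, j). if vs ! i = ws ! j then 1 else 0)"
  define Q :: "complex mat" where "Q = mat n n (\<lambda>(i, j). if ws ! i = vs ! j then 1 else 0)"
  define B where "B = adj_mat \<Gamma> ws"
  have carr: "P \<in> carrier_mat n n" "Q \<in> carrier_mat n n" "B \<in> carrier_mat n n"
      "adj_mat \<Gamma> vs \<in> carrier_mat n n"
    by (auto simp: P_def Q_def B_def adj_mat_def len)
  have mult: "(P * M) $$ (i, j) = M $$ (\<pi> i, j)"
    if "M \<in> carrier_mat n n" "i < n" "j < n" for M i j
  proof -
    have "(P * M) $$ (i, j) = (\<Sum>k\<in>{0..<n}. P $$ (i, k) * M $$ (k, j))"
      using that carr(1) by (simp add: scalar_prod_def)
    also have "\<dots> = (\<Sum>k\<in>{0..<n}. if k = \<pi> i then M $$ (k, j) else 0)"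
      by (rule sum.cong) (use that in \<open>auto simp: P_def iff\<close>)
    finally show ?thesis using \<pi>[OF that(2)] by simp
  qed
  have multQ: "(M * Q) $$ (i, j) = M $$ (i, \<pi> j)"
    if "M \<in> carrier_mat n n" "i < n" "j < n" for M i j
  proof -
    have "(M * Q) $$ (i, j) = (\<Sum>k\<in>{0..<n}. M $$ (i, k) * Q $$ (k, j))"
      using that carr(2) by (simp add: scalar_prod_def)
    also have "\<dots> = (\<Sum>k\<in>{0..<n}. if k = \<pi> j then M $$ (i, k) else 0)"
      by (rule sum.cong) (use that iff in \<open>auto simp: Q_def eq_commute[of "ws ! _"]\<close>)
    finally show ?thesis using \<pi>[OF that(3)] by simp
  qed
  have PQ: "P * Q = 1\<^sub>m n"
  proof (rule eq_matI)
    fix i j assume "i < dim_row (1\<^sub>m n :: complex mat)" "j < dim_col (1\<^sub>m n :: complex mat)"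
    hence ij: "i < n" "j < n" by auto
    show "(P * Q) $$ (i, j) = 1\<^sub>m n $$ (i, j)"
      by (subst mult[OF carr(2) ij]) (simp add: Q_def ij \<pi> ivs)
  qed (use carr in auto)
  have QP: "Q * P = 1\<^sub>m n"
    using mat_mult_left_right_inverse[OF carr(1,2) PQ] .
  have "adj_mat \<Gamma> vs = P * B * Q"
  proof (rule eq_matI)
    fix i j assume "i < dim_row (P * B * Q)" "j < dim_col (P * B * Q)"
    hence ij: "i < n" "j < n" using carr by auto
    have PB: "P * B \<in> carrier_mat n n" using carr by auto
    have "(P * B * Q) $$ (i, j) = B $$ (\<pi> i, \<pi> j)"
      by (simp only: multQ[OF PB ij] mult[OF carr(3) ij(1) \<pi>(1)[OF ij(2)]])
    thus "adj_mat \<Gamma> vs $$ (i, j) = (P * B * Q) $$ (i, j)"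
      by (simp add: B_def adj_mat_def len ij \<pi>)
  qed (use carr in auto)
  thus ?thesis
    using similar_matI[of "adj_mat \<Gamma> vs" B P Q n] carr PQ QP by (auto simp: B_def)
qed

lemma graph_spectrum_eq:
  assumes "distinct vs" "set vs = pverts \<Gamma>"
  shows "graph_spectrum \<Gamma> = proots (char_poly (adj_mat \<Gamma> vs))"
proof -
  define ws where "ws = (SOME vs. distinct vs \<and> set vs = pverts \<Gamma>)"
  have "distinct ws \<and> set ws = pverts \<Gamma>"
    unfolding ws_def by (rule someI[of _ vs]) (use assms in auto)
  hence "similar_mat (adj_mat \<Gamma> ws) (adj_mat \<Gamma> vs)"
    using assms by (intro similar_adj_mat) auto
  from char_poly_similar[OF this] show ?thesis
    by (simp add: graph_spectrum_def ws_def)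
qed


section \<open>Arithmetic data\<close>

definition coprime_residues :: "nat \<Rightarrow> nat set" where
  "coprime_residues n = {t. 1 \<le> t \<and> t \<le> n \<and> gcd t n = 1}"

definition divisors :: "nat \<Rightarrow> nat set" where
  "divisors n = {d. d > 0 \<and> d dvd n}"

definition nonsquarefree_divisors :: "nat \<Rightarrow> nat set" where
  "nonsquarefree_divisors n = {d \<in> divisors n. \<exists>p. prime p \<and> p ^ 2 dvd d}"

text \<open>Only meaningful for square-free \<open>d\<close>, whose number of prime factors is the exponent.\<close>

definition F :: "nat \<Rightarrow> nat \<Rightarrow> complex" where
  "F n d = (- 1) ^ card (prime_factors d) * (of_nat (totient n) / of_nat (totient d))"

end

theory Submission
  imports Defs "HOL-Algebra.Multiplicative_Group"
begin

text \<open>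
  In the basis of powers of \<open>a\<close> the adjacency matrix is circulant, so for each \<open>n\<close>-th root of unity
  \<open>z\<close> the vector with entries \<open>z\<^sup>j\<close> is an eigenvector, with eigenvalue the Ramanujan sum
  \<open>R n z\<close>: the sum of \<open>z\<^sup>t\<close> over the residues \<open>t\<close> coprime to \<open>n\<close>. It only depends on the order \<open>d\<close>
  of \<open>z\<close>, and exactly \<open>\<phi>(d)\<close> of the roots have order \<open>d\<close>.

  To evaluate \<open>R n z\<close>, split off a prime from \<open>n = p * m\<close>. The numbers \<open>t < p * m\<close> coprime to \<open>m\<close> are the
  \<open>u + m * j\<close> with \<open>u\<close> coprime to \<open>m\<close> and \<open>j < p\<close>, and the sum over \<open>j\<close> is geometric: they contribute
  \<open>p * R m z\<close> if \<open>z\<^sup>m = 1\<close>, and \<open>0\<close> otherwise. If \<open>p\<close> divides \<open>m\<close> this is already \<open>R n z\<close>; if not, the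
  multiples of \<open>p\<close> among these \<open>t\<close> have to be removed, and they contribute \<open>R m (z\<^sup>p)\<close>.
\<close>

section \<open>Splitting a prime off a sum over coprime residues\<close>

lemma sum_geometric_root_unity:
  fixes y :: "'a :: field"
  assumes "y ^ n = 1"
  shows "(\<Sum>j<n. y ^ j) = (if y = 1 then of_nat n else 0)"
  using assms by (simp add: geometric_sum)

lemma sum_lessThan_mult:
  fixes f :: "nat \<Rightarrow> 'a :: comm_monoid_add"
  assumes "m > 0"
  shows "(\<Sum>t<p * m. f t) = (\<Sum>u<m. \<Sum>j<p. f (u + m * j))"
proof -
  have "(\<Sum>t<p * m. f t) = (\<Sum>(u, j)\<in>{..<m} \<times> {..<p}. f (u + m * j))"
  proof (rule sum.reindex_bij_witness[where i = "\<lambda>(u, j). u + m * j" and j = "\<lambda>t. (t mod m, t div m)"])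
    fix t assume "t \<in> {..<p * m}"
    then show "(t mod m, t div m) \<in> {..<m} \<times> {..<p}"
      using assms by (simp add: less_mult_imp_div_less)
  next
    fix b assume "b \<in> {..<m} \<times> {..<p}"
    then obtain u j where b: "b = (u, j)" "u < m" "j < p" by auto
    have "u + m * j < m * Suc j" using b by simp
    also have "\<dots> \<le> m * p" using b by (intro mult_le_mono) auto
    finally show "(case b of (u, j) \<Rightarrow> u + m * j) \<in> {..<p * m}"
      using b by (simp add: mult.commute)
  qed (use assms in auto)
  then show ?thesis by (simp add: sum.cartesian_product)
qed

text \<open>The sum \<open>R n z\<close>, taken over remainders below \<open>n\<close>. Representing
  the class of \<open>n\<close> by \<open>0\<close> matters only for \<open>n = 1\<close>, where
  both choices give \<open>1\<close> if \<open>z ^ n = 1\<close>.\<close>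

definition coprime_power_sum :: "nat \<Rightarrow> 'a :: field \<Rightarrow> 'a" where
  "coprime_power_sum n z = (\<Sum>t | t < n \<and> coprime t n. z ^ t)"

lemma coprime_power_sum_lift:
  fixes z :: "'a :: field"
  assumes "m > 0" and "z ^ (p * m) = 1"
  shows "(\<Sum>t | t < p * m \<and> coprime t m. z ^ t) =
           (if z ^ m = 1 then of_nat p * coprime_power_sum m z else 0)"
proof -
  have restrict: "(\<Sum>t | t < k \<and> coprime t m. z ^ t) = (\<Sum>t<k. if coprime t m then z ^ t else 0)"
    for k
    by (simp add: sum.inter_filter[symmetric] lessThan_def conj_commute)
  have "(\<Sum>t | t < p * m \<and> coprime t m. z ^ t) =
          (\<Sum>u<m. \<Sum>j<p. if coprime (u + m * j) m then z ^ (u + m * j) else 0)"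
    unfolding restrict by (rule sum_lessThan_mult[OF assms(1)])
  also have "\<dots> = (\<Sum>u<m. (if coprime u m then z ^ u else 0) * (\<Sum>j<p. (z ^ m) ^ j))"
  proof (rule sum.cong[OF refl])
    fix u
    \<comment> \<open>Coprimality to \<open>m\<close> depends on the residue \<open>u\<close> alone,
      so the test leaves the inner sum and a geometric sum in \<open>z ^ m\<close> remains.\<close>
    have "coprime (u + m * j) m = coprime u m" for j
      by (metis coprime_iff_gcd_eq_1 gcd_add_mult gcd.commute add.commute mult.commute)
    then show "(\<Sum>j<p. if coprime (u + m * j) m then z ^ (u + m * j) else 0) =
        (if coprime u m then z ^ u else 0) * (\<Sum>j<p. (z ^ m) ^ j)"
      by (simp add: sum_distrib_left power_add power_mult)
  qed
  also have "\<dots> = coprime_power_sum m z * (\<Sum>j<p. (z ^ m) ^ j)"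
    by (simp add: sum_distrib_right coprime_power_sum_def restrict)
  also have "(\<Sum>j<p. (z ^ m) ^ j) = (if z ^ m = 1 then of_nat p else 0)"
    by (rule sum_geometric_root_unity) (use assms(2) in \<open>simp add: power_mult[symmetric] mult.commute\<close>)
  finally show ?thesis by simp
qed

lemma coprime_power_sum_mult_prime_dvd:
  fixes z :: "'a :: field"
  assumes "prime p" "p dvd m" "m > 0" "z ^ (p * m) = 1"
  shows "coprime_power_sum (p * m) z =
           (if z ^ m = 1 then of_nat p * coprime_power_sum m z else 0)"
proof -
  have "coprime t (p * m) = coprime t m" for t
    using assms(2) by (metis coprime_divisors coprime_mult_right_iff dvd_refl)
  then show ?thesis
    using coprime_power_sum_lift[OF assms(3,4)] by (simp add: coprime_power_sum_def)
qed

lemma coprime_power_sum_mult_prime_not_dvd: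
  fixes z :: "'a :: field"
  assumes "prime p" "\<not> p dvd m" "m > 0" "z ^ (p * m) = 1"
  shows "coprime_power_sum (p * m) z =
           (if z ^ m = 1 then of_nat p * coprime_power_sum m z else 0) - coprime_power_sum m (z ^ p)"
proof -
  have cop: "coprime p m" using assms(1,2) by (simp add: prime_imp_coprime)
  have p0: "p > 0" using assms(1) by (simp add: prime_gt_0_nat)
  \<comment> \<open>A \<open>t\<close> coprime to \<open>m\<close> fails to be coprime to
    \<open>p * m\<close> only if \<open>p\<close> divides it; conversely \<open>p * u\<close> is
    coprime to \<open>m\<close> because both factors are.\<close>
  have split: "{t. t < p * m \<and> coprime t m} =
      {t. t < p * m \<and> coprime t (p * m)} \<union> (*) p ` {u. u < m \<and> coprime u m}" (is "_ = ?A \<union> ?B")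
  proof (intro equalityI subsetI)
    fix t assume t: "t \<in> {t. t < p * m \<and> coprime t m}"
    show "t \<in> ?A \<union> ?B"
    proof (cases "p dvd t")
      case True
      then obtain u where "t = p * u" by auto
      then show ?thesis using t p0 by auto
    next
      case False
      then have "coprime t p" using assms(1) prime_imp_coprime coprime_commute by blast
      then show ?thesis using t by auto
    qed
  qed (use cop p0 in auto)
  have disj: "?A \<inter> ?B = {}"
    using assms(1) by (auto simp: coprime_mult_left_iff)
  have "(\<Sum>t | t < p * m \<and> coprime t m. z ^ t) = (\<Sum>t\<in>?A. z ^ t) + (\<Sum>t\<in>?B. z ^ t)"
    unfolding split by (rule sum.union_disjoint) (use disj in auto)
  also have "(\<Sum>t\<in>?B. z ^ t) = coprime_power_sum m (z ^ p)"
    using p0 by (subst sum.reindex) (auto simp: inj_on_def coprime_power_sum_def power_mult)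
  finally show ?thesis
    using coprime_power_sum_lift[OF assms(3,4)] by (simp add: coprime_power_sum_def eq_diff_eq)
qed

section \<open>Closed form of the Ramanujan sums\<close>

text \<open>Hoelder's formula mu(d) phi(n) / phi(d), with mu the Moebius function.\<close>

definition ramanujan_value :: "nat \<Rightarrow> nat \<Rightarrow> complex" where
  "ramanujan_value n d = (if squarefree d then F n d else 0)"

lemma totient_mult_prime_dvd:
  assumes "prime p" "p dvd m"
  shows "totient (p * m) = p * totient m"
proof -
  \<comment> \<open>By \<open>totient_gcd\<close>, phi(p m) phi(g) = phi(p) phi(m) g for g = gcd(p,
    m). With g = p the factor phi(p) cancels.\<close>
  have "gcd p m = p" using assms(2) by (simp add: gcd_proj1_iff)
  moreover have "totient p > 0" using assms(1) by (simp add: prime_gt_0_nat)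
  ultimately show ?thesis using totient_gcd[of p m] by simp
qed

lemma totient_mult_prime_not_dvd:
  assumes "prime p" "\<not> p dvd m"
  shows "totient (p * m) = (p - 1) * totient m"
  using assms by (simp add: totient_mult_coprime prime_imp_coprime totient_prime)

text \<open>The additional prime factor flips the sign, while the factor \<open>p - 1\<close> gained
  by both totients cancels in their quotient.\<close>

lemma ramanujan_value_mult_prime:
  assumes "prime p" "\<not> p dvd e" "\<not> p dvd m" "e > 0"
  shows "ramanujan_value (p * m) (p * e) = - ramanujan_value m e"
proof -
  have cop: "coprime p e" using assms by (simp add: prime_imp_coprime)
  have "squarefree (p * e) \<longleftrightarrow> squarefree e"
    using squarefree_mult_coprime[OF cop] squarefree_prime[OF assms(1)] squarefree_multD(2) by blast
  moreover have "prime_factors (p * e) = insert p (prime_factors e)"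
    using assms by (simp add: prime_factors_product prime_prime_factors prime_gt_0_nat)
  moreover have "p \<notin> prime_factors e" using assms by auto
  moreover have "p - 1 > 0" using prime_gt_1_nat[OF assms(1)] by simp
  ultimately show ?thesis
    using assms by (auto simp: ramanujan_value_def F_def totient_mult_prime_not_dvd simp del: of_nat_diff)
qed

text \<open>The third hypothesis says that \<open>z\<close> has order exactly \<open>d\<close>. The
  induction removes one prime from \<open>n\<close>; \<open>d\<close> and \<open>z\<close> must
  vary, since \<open>z ^ p\<close> takes the place of \<open>z\<close> and may have smaller
  order.\<close>

lemma coprime_power_sum_eq:
  fixes z :: complex
  assumes "n > 0" "d dvd n" "\<And>k. z ^ k = 1 \<longleftrightarrow> d dvd k"
  shows "coprime_power_sum n z = ramanujan_value n d"
  using assms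
proof (induction n arbitrary: d z rule: less_induct)
  case (less n)
  show ?case
  proof (cases "n = 1")
    case True
    then show ?thesis using less.prems
      by (simp add: coprime_power_sum_def ramanujan_value_def F_def)
  next
    case False
    then obtain p where p: "prime p" "p dvd n" using prime_factor_nat by blast
    then obtain m where n: "n = p * m" by auto
    have m: "m > 0" "m < n" using less.prems(1) n prime_gt_1_nat[OF p(1)] by auto
    have d0: "d > 0" using less.prems by (metis dvd_0_left_iff neq0_conv)
    have zn: "z ^ (p * m) = 1" using less.prems n by simp
    show ?thesis
    proof (cases "p dvd m")
      case True
      show ?thesis
      proof (cases "d dvd m")
        case dm: True
        \<comment> \<open>Here \<open>z ^ m = 1\<close>, and the factor \<open>p\<close> is the
          ratio phi(n) / phi(m).\<close>
        have "coprime_power_sum n z = of_nat p * ramanujan_value m d"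
          using coprime_power_sum_mult_prime_dvd[OF p(1) True m(1) zn] less.IH[OF m(2,1) dm less.prems(3)]
            dm less.prems(3) n by simp
        then show ?thesis
          by (simp add: ramanujan_value_def F_def n totient_mult_prime_dvd[OF p(1) True])
      next
        case dm: False
        \<comment> \<open>The sum vanishes as \<open>z ^ m\<close> is not \<open>1\<close>, so
          \<open>d\<close> must have a square factor. Otherwise the part of \<open>d\<close> prime
          to \<open>p\<close> divides \<open>m\<close>, as does \<open>p\<close> itself, and hence
          so does \<open>d\<close>.\<close>
        have "\<not> squarefree d"
        proof
          assume sf: "squarefree d"
          have "d dvd m"
          proof (cases "p dvd d")
            case pd: True
            then obtain e where e: "d = p * e" by auto
            have "\<not> p dvd e" using sf e p(1) squarefreeD[of d p]
              by (auto simp: power2_eq_square)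
            then have "coprime p e" using p(1) by (simp add: prime_imp_coprime)
            moreover have "e dvd m" using less.prems(2) e n p(1) by (simp add: prime_gt_0_nat)
            ultimately show ?thesis using True e by (simp add: divides_mult)
          next
            case False
            then have "coprime d p" using p(1) prime_imp_coprime coprime_commute by blast
            then show ?thesis using less.prems(2) n by (simp add: coprime_dvd_mult_right_iff)
          qed
          with dm show False ..
        qed
        then show ?thesis
          using coprime_power_sum_mult_prime_dvd[OF p(1) True m(1) zn] dm less.prems(3) n
          by (simp add: ramanujan_value_def)
      qed
    next
      case False
      show ?thesis
      proof (cases "d dvd m")
        case dm: True
        then have "\<not> p dvd d" using False dvd_trans by blast
        then have "coprime d p" using p(1) prime_imp_coprime coprime_commute by blast
        \<comment> \<open>Raising to the power \<open>p\<close> keeps the order \<open>d\<close>, so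
          both terms involve the same value and combine to the factor \<open>p - 1\<close>.\<close>
        then have ord: "(z ^ p) ^ k = 1 \<longleftrightarrow> d dvd k" for k
          using less.prems(3)[of "p * k"] by (simp add: power_mult[symmetric] coprime_dvd_mult_right_iff)
        have "coprime_power_sum n z = (of_nat p - 1) * ramanujan_value m d"
          using coprime_power_sum_mult_prime_not_dvd[OF p(1) False m(1) zn]
            less.IH[OF m(2,1) dm less.prems(3)] less.IH[OF m(2,1) dm ord]
            dm less.prems(3) n by (simp add: algebra_simps)
        then show ?thesis
          using prime_gt_0_nat[OF p(1)]
          by (simp add: ramanujan_value_def F_def n totient_mult_prime_not_dvd[OF p(1) False] of_nat_diff)
      next
        case dm: False
        have "p dvd d"
        proof (rule ccontr)
          assume "\<not> p dvd d"
          then have "coprime d p" using p(1) prime_imp_coprime coprime_commute by blast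
          with dm show False using less.prems(2) n by (simp add: coprime_dvd_mult_right_iff)
        qed
        then obtain e where e: "d = p * e" by auto
        have em: "e dvd m" using less.prems(2) e n p(1) by (simp add: prime_gt_0_nat)
        have pe: "\<not> p dvd e" using em False dvd_trans by blast
        \<comment> \<open>Only the subtracted term survives, because \<open>z ^ m\<close> is not
          \<open>1\<close>; the order of \<open>z ^ p\<close> is \<open>e\<close>, the order of
          \<open>z\<close> divided by \<open>p\<close>.\<close>
        have ord: "(z ^ p) ^ k = 1 \<longleftrightarrow> e dvd k" for k
          using less.prems(3)[of "p * k"] e prime_gt_0_nat[OF p(1)] by (simp add: power_mult[symmetric])
        have "coprime_power_sum n z = - ramanujan_value m e"
          using coprime_power_sum_mult_prime_not_dvd[OF p(1) False m(1) zn]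
            less.IH[OF m(2,1) em ord] dm less.prems(3) n by simp
        then show ?thesis
          using ramanujan_value_mult_prime[OF p(1) pe False] d0 e n by simp
      qed
    qed
  qed
qed

section \<open>Roots of unity and the orders of their powers\<close>

lemma cis_root_unity_power_eq_1_iff:
  assumes "n > 0"
  shows "cis (2 * pi / real n) ^ k = 1 \<longleftrightarrow> n dvd k"
proof
  assume "cis (2 * pi / real n) ^ k = 1"
  then have "cos (real k * (2 * pi / real n)) = 1"
    by (simp add: Complex.DeMoivre complex_eq_iff)
  then obtain m :: int where "real k * (2 * pi / real n) = m * 2 * pi"
    by (auto simp: cos_one_2pi_int)
  then have "real k = m * real n" using assms by (simp add: field_simps)
  then have "int k = m * int n" by (metis of_int_eq_iff of_int_mult of_int_of_nat_eq)
  then show "n dvd k" by (metis dvd_triv_right int_dvd_int_iff)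
next
  assume "n dvd k"
  then obtain m where "k = n * m" ..
  then show "cis (2 * pi / real n) ^ k = 1"
    using assms by (simp add: power_mult Complex.DeMoivre)
qed

text \<open>Once the gcd is cancelled, the remaining factors are coprime. For \<open>w\<close> of
  order \<open>n\<close> this gives the order of \<open>w ^ k\<close> as
  \<open>n div gcd k n\<close>.\<close>

lemma dvd_mult_iff_div_gcd_dvd:
  fixes n k m :: nat
  assumes "n > 0"
  shows "n dvd k * m \<longleftrightarrow> n div gcd k n dvd m"
proof -
  define g where "g = gcd k n"
  have g: "g > 0" using assms by (simp add: g_def)
  have "coprime (n div g) (k div g)"
    unfolding g_def by (metis assms coprime_commute div_gcd_coprime less_irrefl)
  moreover have "n dvd k * m \<longleftrightarrow> g * (n div g) dvd g * ((k div g) * m)"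
    by (simp only: mult.assoc[symmetric] g_def dvd_mult_div_cancel gcd_dvd1 gcd_dvd2)
  ultimately show ?thesis
    using g by (simp add: coprime_dvd_mult_right_iff flip: g_def)
qed

lemma div_gcd_dvd: "n div gcd k n dvd (n :: nat)"
  by (metis dvd_mult_div_cancel dvd_triv_right gcd_dvd2)

section \<open>Diagonalisation by the Fourier matrix\<close>

text \<open>The power vectors are the columns of an invertible matrix, so they diagonalise
  \<open>A\<close>. This settles algebraic multiplicities even when values of \<open>e\<close>
  coincide.\<close>

lemma proots_char_poly_power_eigenvectors:
  fixes w :: "'a :: field_char_0" and A :: "'a mat"
  assumes n: "n > 0" and A: "A \<in> carrier_mat n n"
    and w: "\<And>k. w ^ k = 1 \<longleftrightarrow> n dvd k"
    and eigen: "\<And>i k. i < n \<Longrightarrow> k \<in> {0<..n} \<Longrightarrow>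
      (\<Sum>j<n. A $$ (i, j) * (w ^ k) ^ j) = e k * (w ^ k) ^ i"
  shows "proots (char_poly A) = image_mset e (mset_set {0<..n})"
proof -
  have w0: "w \<noteq> 0" using w[of n] n by (auto simp: power_0_left)
  \<comment> \<open>Matrix indices start at \<open>0\<close> but \<open>k\<close> runs over
    \<open>1..n\<close>, hence \<open>Suc k\<close>. \<open>W\<close> is the inverse Fourier matrix;
    characteristic 0 allows the division by \<open>n\<close>.\<close>
  define V where "V = mat n n (\<lambda>(i, k). (w ^ Suc k) ^ i)"
  define W where "W = mat n n (\<lambda>(k, j). inverse (of_nat n * (w ^ Suc k) ^ j))"
  define E where "E = mat n n (\<lambda>(i, j). if i = j then e (Suc i) else 0)"
  have carr: "V \<in> carrier_mat n n" "W \<in> carrier_mat n n" "E \<in> carrier_mat n n"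
    by (auto simp: V_def W_def E_def)
  have VW: "V * W = 1\<^sub>m n"
  proof (rule eq_matI)
    fix i j assume "i < dim_row (1\<^sub>m n :: 'a mat)" "j < dim_col (1\<^sub>m n :: 'a mat)"
    then have ij: "i < n" "j < n" by auto
    \<comment> \<open>Entry \<open>(i, j)\<close> of \<open>V * W\<close> is the average of
      \<open>y ^ Suc k\<close> over \<open>k < n\<close>, a geometric sum that vanishes unless
      \<open>y = 1\<close>.\<close>
    define y where "y = w ^ i / w ^ j"
    have "y ^ n = 1"
      using w[of "i * n"] w[of "j * n"] by (simp add: y_def power_divide power_mult)
    have "y = 1 \<longleftrightarrow> i = j"
    proof
      assume "y = 1"
      then have eq: "w ^ i = w ^ j" using w0 by (simp add: y_def)
      have "i = j" if "w ^ i = w ^ j" "i \<le> j" "j < n" for i j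
      proof -
        have "w ^ (j - i) = 1" using that w0 by (simp add: power_diff)
        then show ?thesis using that w[of "j - i"] by (auto dest: dvd_imp_le)
      qed
      then show "i = j" using eq ij by (metis nle_le)
    qed (use w0 in \<open>simp add: y_def\<close>)
    have "(V * W) $$ (i, j) = (\<Sum>k<n. (w ^ Suc k) ^ i * inverse (of_nat n * (w ^ Suc k) ^ j))"
      using ij by (simp add: V_def W_def scalar_prod_def lessThan_atLeast0)
    also have "\<dots> = (\<Sum>k<n. y * y ^ k / of_nat n)"
      by (rule sum.cong)
        (simp_all add: y_def power_divide divide_simps w0 power_mult_distrib mult.commute
          flip: power_mult power_add)
    also have "\<dots> = y * (\<Sum>k<n. y ^ k) / of_nat n"
      by (simp add: sum_distrib_left sum_divide_distrib)
    also have "\<dots> = 1\<^sub>m n $$ (i, j)"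
      using \<open>y = 1 \<longleftrightarrow> i = j\<close> ij n by (simp add: sum_geometric_root_unity[OF \<open>y ^ n = 1\<close>])
    finally show "(V * W) $$ (i, j) = 1\<^sub>m n $$ (i, j)" .
  qed (use carr in auto)
  have AV: "A * V = V * E"
  proof (rule eq_matI)
    fix i k assume "i < dim_row (V * E)" "k < dim_col (V * E)"
    then have ik: "i < n" "k < n" using carr by auto
    have "(A * V) $$ (i, k) = (\<Sum>j<n. A $$ (i, j) * (w ^ Suc k) ^ j)"
      using ik A by (simp add: V_def scalar_prod_def lessThan_atLeast0)
    also have "\<dots> = e (Suc k) * (w ^ Suc k) ^ i"
      using ik by (intro eigen) auto
    also have "\<dots> = (\<Sum>j<n. if j = k then e (Suc k) * (w ^ Suc k) ^ i else 0)"
      using ik by simp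
    also have "\<dots> = (\<Sum>j<n. (w ^ Suc j) ^ i * (if j = k then e (Suc j) else 0))"
      by (rule sum.cong) auto
    also have "\<dots> = (V * E) $$ (i, k)"
      using ik by (simp add: V_def E_def scalar_prod_def lessThan_atLeast0)
    finally show "(A * V) $$ (i, k) = (V * E) $$ (i, k)" .
  qed (use carr A in auto)
  have "A = A * (V * W)" using A VW by simp
  also have "\<dots> = V * E * W" using A carr AV by (simp flip: assoc_mult_mat[of A n n V n W n])
  finally have "similar_mat A E"
    using A carr VW mat_mult_left_right_inverse[OF carr(1,2) VW] by (intro similar_matI[of A E V W n]) auto
  then have "char_poly A = char_poly E" by (rule char_poly_similar)
  also have "\<dots> = (\<Prod>a \<leftarrow> diag_mat E. [:- a, 1:])"
    by (rule char_poly_upper_triangular[OF carr(3)]) (auto simp: E_def)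
  also have "diag_mat E = map (\<lambda>k. e (Suc k)) [0..<n]"
    by (auto simp: diag_mat_def E_def)
  finally have "char_poly A = (\<Prod>k\<in>{..<n}. [:- e (Suc k), 1:])"
    by (simp add: comp_def prod.distinct_set_conv_list[symmetric] lessThan_atLeast0)
  then have "proots (char_poly A) = (\<Sum>k<n. {#e (Suc k)#})"
    by (simp add: proots_prod)
  also have "\<dots> = image_mset e (image_mset Suc (mset_set {..<n}))"
    by (simp add: sum_unfold_sum_mset image_mset.compositionality comp_def)
  also have "image_mset Suc (mset_set {..<n}) = mset_set {0<..n}"
    by (simp add: image_mset_mset_set lessThan_atLeast0 image_Suc_atLeastLessThan
        atLeastLessThanSuc_atLeastAtMost atLeastSucAtMost_greaterThanAtMost)
  finally show ?thesis .
qed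

section \<open>Multiplicities of the eigenvalues\<close>

lemma sum_singleton_mset_const: "(\<Sum>x\<in>A. {#c#}) = replicate_mset (card A) c"
  by (induction A rule: infinite_finite_induct) auto

text \<open>Grouping the exponents \<open>k\<close> by the order \<open>d\<close> of the
  corresponding root: the condition becomes \<open>gcd k n = n div d\<close>, met by
  \<open>totient d\<close> of them.\<close>

lemma image_mset_div_gcd:
  assumes "n > 0"
  shows "image_mset (\<lambda>k. f (n div gcd k n)) (mset_set {0<..n}) =
           (\<Sum>d\<in>divisors n. replicate_mset (totient d) (f d))"
proof -
  have fin: "finite (divisors n)"
    using assms by (auto simp: divisors_def)
  have "image_mset (\<lambda>k. f (n div gcd k n)) (mset_set {0<..n}) =
          (\<Sum>k\<in>{0<..n}. {#f (n div gcd k n)#})"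
    by (simp add: sum_unfold_sum_mset)
  also have "\<dots> = (\<Sum>d\<in>divisors n. \<Sum>k | k \<in> {0<..n} \<and> n div gcd k n = d. {#f (n div gcd k n)#})"
    by (rule sum.group[symmetric]) (use fin assms in \<open>auto simp: divisors_def div_greater_zero_iff gcd_le2_nat div_gcd_dvd\<close>)
  also have "\<dots> = (\<Sum>d\<in>divisors n. replicate_mset (totient d) (f d))"
  proof (rule sum.cong[OF refl])
    fix d assume "d \<in> divisors n"
    then have d: "d dvd n" "d > 0" by (auto simp: divisors_def)
    have "n div gcd k n = d \<longleftrightarrow> gcd k n = n div d" for k
    proof -
      have "d * (n div d) = n" "(n div gcd k n) * gcd k n = n" using d by auto
      then show ?thesis using assms d(2)
        by (metis mult_is_0 nonzero_mult_div_cancel_left nonzero_mult_div_cancel_right less_irrefl)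
    qed
    then have "{k. k \<in> {0<..n} \<and> n div gcd k n = d} = {k \<in> {0<..n}. gcd k n = n div d}"
      by auto
    then have "card {k. k \<in> {0<..n} \<and> n div gcd k n = d} = totient d"
      using card_gcd_eq_totient[OF assms, of "n div d"] d assms
      by (simp add: div_dvd_iff_mult div_div_eq_right)
    moreover have "(\<Sum>k | k \<in> {0<..n} \<and> n div gcd k n = d. {#f (n div gcd k n)#}) =
        (\<Sum>k | k \<in> {0<..n} \<and> n div gcd k n = d. {#f d#})"
      by (rule sum.cong) auto
    ultimately show "(\<Sum>k | k \<in> {0<..n} \<and> n div gcd k n = d. {#f (n div gcd k n)#}) =
        replicate_mset (totient d) (f d)"
      by (simp only: sum_singleton_mset_const)
  qed
  finally show ?thesis .
qed

section \<open>The circulant adjacency matrix of the Cayley graph\<close>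

text \<open>This is row \<open>i\<close> of the circulant matrix applied to the powers of
  \<open>z\<close>. Substituting \<open>j = (i + t) mod n\<close> turns \<open>z ^ j\<close> into
  \<open>z ^ t * z ^ i\<close>, and \<open>i - j\<close> into \<open>- t\<close> modulo
  \<open>n\<close>, where the sign does not affect coprimality.\<close>

lemma sum_coprime_shift:
  fixes z :: "'a :: field"
  assumes "i < n" "z ^ n = 1"
  shows "(\<Sum>j<n. (if coprime (int i - int j) (int n) then 1 else 0) * z ^ j) =
           coprime_power_sum n z * z ^ i"
proof -
  have n: "n > 0" using assms(1) by simp
  have mod_power: "z ^ (m mod n) = z ^ m" for m
    using assms(2) by (metis mod_mult_div_eq mult.commute mult_1 power_add power_mult power_one)
  have cop: "coprime (int i - int ((i + t) mod n)) (int n) \<longleftrightarrow> coprime t n" for t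
  proof -
    have "[int i - int ((i + t) mod n) = int i - int (i + t)] (mod int n)"
      by (intro cong_diff) (auto simp: cong_def of_nat_mod)
    then have cong: "[int i - int ((i + t) mod n) = - int t] (mod int n)" by simp
    show ?thesis
      using cong_imp_coprime[OF cong] cong_imp_coprime[OF cong_sym[OF cong]] by auto
  qed
  have "(\<Sum>j<n. (if coprime (int i - int j) (int n) then 1 else 0) * z ^ j) =
          (\<Sum>t<n. (if coprime t n then 1 else 0) * z ^ t * z ^ i)"
  \<comment> \<open>Adding \<open>n\<close> before subtracting \<open>i\<close> avoids truncated
    subtraction.\<close>
  proof (rule sum.reindex_bij_witness[where i = "\<lambda>t. (i + t) mod n" and j = "\<lambda>j. (j + n - i) mod n"])
    fix j assume "j \<in> {..<n}"
    then have j: "j < n" by simp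
    have "(i + (j + n - i) mod n) mod n = (i + (j + n - i)) mod n" by presburger
    then show *: "(i + (j + n - i) mod n) mod n = j" using j assms(1) by simp
    show "(if coprime ((j + n - i) mod n) n then 1 else 0) * z ^ ((j + n - i) mod n) * z ^ i =
        (if coprime (int i - int j) (int n) then 1 else 0) * z ^ j"
    proof -
      have "z ^ ((j + n - i) mod n) * z ^ i = z ^ j"
        using mod_power[of "i + (j + n - i) mod n"] * by (simp add: power_add mult.commute)
      moreover have "coprime ((j + n - i) mod n) n \<longleftrightarrow> coprime (int i - int j) (int n)"
        using cop[of "(j + n - i) mod n"] * by simp
      ultimately show ?thesis by simp
    qed
  next
    fix t assume "t \<in> {..<n}"
    then have t: "t < n" by simp
    show "((i + t) mod n + n - i) mod n = t"
    proof (cases "i + t < n")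
      case True
      then show ?thesis using t by simp
    next
      case False
      then have "(i + t) mod n = i + t - n" using assms(1) t by (simp add: le_mod_geq)
      then show ?thesis using False t by simp
    qed
  qed (use n in auto)
  also have "\<dots> = coprime_power_sum n z * z ^ i"
  proof -
    have "(\<Sum>t<n. (if coprime t n then 1 else 0) * z ^ t * z ^ i) =
        (\<Sum>t\<in>{..<n}. if coprime t n then z ^ t * z ^ i else 0)"
      by (rule sum.cong) auto
    also have "\<dots> = (\<Sum>t | t \<in> {..<n} \<and> coprime t n. z ^ t * z ^ i)"
      by (rule sum.inter_filter[symmetric]) simp
    finally show ?thesis by (simp add: coprime_power_sum_def sum_distrib_right)
  qed
  finally show ?thesis .
qed

text \<open>The quotient is the power of \<open>a\<close> with exponent \<open>i - j\<close>, which
  matters only modulo \<open>n\<close>. Integers are used because \<open>i - j\<close> may be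
  negative.\<close>

lemma (in group) pow_mult_inv_pow_in_coprime_iff:
  assumes "a \<in> carrier G" "ord a = n" "n > 0"
  shows "a [^] (i::nat) \<otimes> inv (a [^] (j::nat)) \<in> {a [^] t | t. t \<in> coprime_residues n} \<longleftrightarrow>
           coprime (int i - int j) (int n)"
proof -
  have quot: "a [^] i \<otimes> inv (a [^] j) = a [^] (int i - int j)"
    using assms(1) by (simp add: int_pow_diff int_pow_int)
  have eq: "a [^] (int i - int j) = a [^] t \<longleftrightarrow> [int t = int i - int j] (mod int n)" for t :: nat
    using int_pow_eq[OF assms(1), of "int i - int j" "int t"] assms(2)
    by (simp add: int_pow_int cong_iff_dvd_diff cong_sym_eq[of "int t"] dvd_diff_commute)
  have "(\<exists>t\<in>coprime_residues n. [int t = int i - int j] (mod int n)) \<longleftrightarrow>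
      coprime (int i - int j) (int n)"
  proof
    assume "\<exists>t\<in>coprime_residues n. [int t = int i - int j] (mod int n)"
    then obtain t where t: "coprime t n" "[int t = int i - int j] (mod int n)"
      by (auto simp: coprime_residues_def coprime_iff_gcd_eq_1)
    from cong_imp_coprime[OF t(2)] t(1) show "coprime (int i - int j) (int n)" by simp
  next
    assume cop: "coprime (int i - int j) (int n)"
    define r where "r = nat ((int i - int j) mod int n)"
    have r: "int r = (int i - int j) mod int n" "r < n" using assms(3) by (auto simp: r_def nat_less_iff)
    \<comment> \<open>\<open>coprime_residues\<close> uses the representatives \<open>1..n\<close>,
      so remainder \<open>0\<close> becomes \<open>n\<close>; under \<open>cop\<close> this happens
      only for \<open>n = 1\<close>.\<close>
    define t where "t = (if r = 0 then n else r)"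
    have t: "[int t = int i - int j] (mod int n)" using r by (auto simp: t_def cong_def)
    then have "coprime t n" using cop cong_imp_coprime[OF cong_sym[OF t]] by simp
    moreover have "1 \<le> t" "t \<le> n" using r assms(3) by (auto simp: t_def)
    ultimately have "t \<in> coprime_residues n"
      by (simp add: coprime_residues_def coprime_iff_gcd_eq_1)
    with t show "\<exists>t\<in>coprime_residues n. [int t = int i - int j] (mod int n)" by blast
  qed
  then show ?thesis unfolding quot using eq by auto
qed

lemma graph_spectrum_unitary_cayley:
  fixes G (structure)
  assumes "group G" "a \<in> carrier G" "carrier G = generate G {a}" "Coset.order G = n" "n > 0"
  shows "graph_spectrum (cayley_graph G {a [^] i | i. i \<in> coprime_residues n}) =
           (\<Sum>d\<in>divisors n. replicate_mset (totient d) (ramanujan_value n d))"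
proof -
  interpret group G by fact
  let ?\<Gamma> = "cayley_graph G {a [^] i | i. i \<in> coprime_residues n}"
  have ord: "ord a = n"
    using generate_pow_card[OF assms(2)] assms(3,4) by (simp add: Coset.order_def)
  \<comment> \<open>Listing the vertices as successive powers of \<open>a\<close> makes the
    adjacency matrix circulant. They are \<open>n\<close> distinct elements of a group of order
    \<open>n\<close>, hence all of it.\<close>
  define vs where "vs = map (\<lambda>i. a [^] i) [0..<n]"
  have inj: "inj_on (\<lambda>i::nat. a [^] i) {..<n}"
    using ord_inj[OF assms(2)] ord assms(5) by (auto simp: inj_on_def)
  then have dist: "distinct vs"
    by (simp add: vs_def distinct_map lessThan_atLeast0)
  have "set vs \<subseteq> carrier G" using assms(2) by (auto simp: vs_def)
  moreover have "finite (carrier G)" "card (set vs) = card (carrier G)"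
    using assms(4,5) distinct_card[OF dist]
    by (auto simp: Coset.order_def vs_def intro: card_ge_0_finite)
  ultimately have "set vs = carrier G" by (simp add: card_subset_eq)
  then have vs: "set vs = pverts ?\<Gamma>" by (simp add: cayley_graph_def)
  define A where "A = adj_mat ?\<Gamma> vs"
  have A: "A \<in> carrier_mat n n" by (simp add: A_def adj_mat_def vs_def)
  have entry: "A $$ (i, j) = (if coprime (int i - int j) (int n) then 1 else 0)"
    if "i < n" "j < n" for i j
    using that assms(2,5) pow_mult_inv_pow_in_coprime_iff[OF assms(2) ord assms(5), of i j]
    by (simp add: A_def adj_mat_def vs_def cayley_graph_def)
  define w where "w = cis (2 * pi / real n)"
  have w: "w ^ k = 1 \<longleftrightarrow> n dvd k" for k
    unfolding w_def using assms(5) by (rule cis_root_unity_power_eq_1_iff)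
  have "proots (char_poly A) =
      image_mset (\<lambda>k. ramanujan_value n (n div gcd k n)) (mset_set {0<..n})"
  proof (rule proots_char_poly_power_eigenvectors[OF assms(5) A w])
    fix i k assume i: "i < n"
    \<comment> \<open>The eigenvalue for \<open>w ^ k\<close> is determined by the order of this
      root.\<close>
    have wk: "(w ^ k) ^ m = 1 \<longleftrightarrow> n div gcd k n dvd m" for m
      using w[of "k * m"] dvd_mult_iff_div_gcd_dvd[OF assms(5)] by (simp add: power_mult)
    have "(\<Sum>j<n. A $$ (i, j) * (w ^ k) ^ j) = coprime_power_sum n (w ^ k) * (w ^ k) ^ i"
      using sum_coprime_shift[OF i, of "w ^ k"] wk[of n] i
      by (simp add: entry div_gcd_dvd)
    also have "coprime_power_sum n (w ^ k) = ramanujan_value n (n div gcd k n)"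
      using assms(5) wk by (intro coprime_power_sum_eq) (auto simp: div_gcd_dvd)
    finally show "(\<Sum>j<n. A $$ (i, j) * (w ^ k) ^ j) =
        ramanujan_value n (n div gcd k n) * (w ^ k) ^ i" .
  qed
  then show ?thesis
    using graph_spectrum_eq[OF dist vs] image_mset_div_gcd[OF assms(5), of "ramanujan_value n"]
    by (simp add: A_def)
qed

lemma replicate_mset_sum: "(\<Sum>x\<in>A. replicate_mset (f x) c) = replicate_mset (\<Sum>x\<in>A. f x) c"
  by (induction A rule: infinite_finite_induct) (auto simp: multiset_eq_iff)

theorem theorem3p1:
  fixes G :: "('a, 'b) monoid_scheme" and a :: 'a and n :: nat
    and S :: "'a set" and D X :: "nat set"
  assumes "n \<ge> 2"
    and "D = divisors n"
    and "group G"
    and "a \<in> carrier G"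
    and "carrier G = generate G {a}"
    and "Coset.order G = n"
    and "S = {a [^]\<^bsub>G\<^esub> i | i. i \<in> coprime_residues n}"
    and "X = nonsquarefree_divisors n"
  shows "graph_spectrum (cayley_graph G S) =
           replicate_mset 1 (of_nat (totient n))
         + replicate_mset (\<Sum>x\<in>X. totient x) 0
         + (\<Sum>d\<in>D - (X \<union> {1}). replicate_mset (totient d) (F n d))"
proof -
  let ?r = "\<lambda>d. replicate_mset (totient d) (ramanujan_value n d)"
  have n: "n > 0" using assms(1) by simp
  \<comment> \<open>\<open>X\<close> collects exactly the orders at which
    \<open>ramanujan_value\<close> is \<open>0\<close>.\<close>
  have X: "X = {d \<in> D. \<not> squarefree d}"
    using assms(2,8) by (auto simp: nonsquarefree_divisors_def divisors_def squarefree_factorial_semiring)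
  have fin: "finite D" using n assms(2) by (auto simp: divisors_def)
  have "1 \<in> D" "1 \<notin> X" using n assms(2) by (auto simp: X divisors_def)
  then have D: "D = {1} \<union> X \<union> (D - (X \<union> {1}))" by (auto simp: X)
  have "graph_spectrum (cayley_graph G S) = sum ?r D"
    using graph_spectrum_unitary_cayley[OF assms(3-6) n] assms(2,7) by simp
  also have "\<dots> = sum ?r {1} + sum ?r X + sum ?r (D - (X \<union> {1}))"
    by (subst D, subst sum.union_disjoint, simp, use fin \<open>1 \<notin> X\<close> X in auto)
  \<comment> \<open>Order \<open>1\<close> belongs to the constant eigenvector, whose eigenvalue is
    the degree phi(n).\<close>
  also have "sum ?r {1} = replicate_mset 1 (of_nat (totient n))"
    by (simp add: ramanujan_value_def F_def)
  also have "sum ?r X = replicate_mset (\<Sum>x\<in>X. totient x) 0"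
    by (simp add: X ramanujan_value_def flip: replicate_mset_sum)
  also have "sum ?r (D - (X \<union> {1})) = (\<Sum>d\<in>D - (X \<union> {1}). replicate_mset (totient d) (F n d))"
    by (rule sum.cong) (auto simp: X ramanujan_value_def)
  finally show ?thesis .
qed

end
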